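(* For every integer $m\ge1$, the algebra $A(m,2)$ has the following presentations: $$A(m,2)\cong\frac{\mathbb{Q}[e_1,e_2]}{(f_m(e_1,e_2),e_2^m)}=\frac{\mathbb{Q}[e_1,e_2]}{\operatorname{Ann}(F_m(E_1,E_2))},$$ where $$f_m(e_1,e_2)=\sum_{k=0}^{\lfloor m/2\rfloor}(-1)^k\frac{m}{m-k}\binom{m-k}{k}e_1^{m-2k}e_2^k$$ and $$F_m(E_1,E_2)=\sum_{n=0}^{m-1}\frac{m}{m+2n}\binom{m+2n}{n}\frac{E_1^{m+2n-1}E_2^{m-n-1}}{(m+2n-1)!\,(m-n-1)!}.$$
   Context: Let $e_1=x_1+x_2$ and $e_2=x_1x_2$ in $\mathbb{Q}[x_1,x_2]$, so that $\mathbb{Q}[e_1,e_2]$ is the polynomial ring of symmetric polynomials, graded by $\deg(e_1)=1$, $\deg(e_2)=2$. Let $e_1(m)=x_1^m+x_2^m$ and $e_2(m)=x_1^mx_2^m$, viewed as elements of $\mathbb{Q}[e_1,e_2]$. The algebra $A(m,2)$ is the graded quotient $\mathbb{Q}[e_1,e_2]/(e_1(m),e_2(m))$. The ring $\mathbb{Q}[e_1,e_2]$ acts on the polynomial ring $\mathbb{Q}[E_1,E_2]$ (with $\deg(E_i)=i$) by partial differentiation: $e_i\circ F=\partial F/\partial E_i$ for $i=1,2$, extended to all of $\mathbb{Q}[e_1,e_2]$ as a module action. For $F\in\mathbb{Q}[E_1,E_2]$, $\operatorname{Ann}(F)=\{f\in\mathbb{Q}[e_1,e_2] : f\circ F=0\}$.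 *)

theory Defs
  imports "HOL-Computational_Algebra.Polynomial" "HOL-Algebra.QuotRing" "HOL-Algebra.Module"
begin

text \<open>
  The type \<^typ>\<open>rat poly poly\<close> serves as the polynomial ring in two variables for
  each of \<open>\<rat>[x\<^sub>1,x\<^sub>2]\<close>, \<open>\<rat>[e\<^sub>1,e\<^sub>2]\<close> and \<open>\<rat>[E\<^sub>1,E\<^sub>2]\<close>. The first variable is the one of
  the coefficient polynomials, the second is the outer one, so that the coefficient of
  \<open>v\<^sub>1^i v\<^sub>2^j\<close> in \<open>p\<close> is \<open>coeff (coeff p j) i\<close>.
\<close>

type_synonym bipoly = "rat poly poly"

definition const2 :: "rat \<Rightarrow> bipoly" where
  "const2 c = [:[:c:]:]"

definition V1 :: bipoly where
  "V1 = [:[:0, 1:]:]"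

definition V2 :: bipoly where
  "V2 = [:0, 1:]"

definition coeff2 :: "bipoly \<Rightarrow> nat \<Rightarrow> nat \<Rightarrow> rat" where
  "coeff2 p i j = coeff (coeff p j) i"

definition subst2 :: "bipoly \<Rightarrow> bipoly \<Rightarrow> bipoly \<Rightarrow> bipoly" where
  "subst2 p a b = (\<Sum>j\<le>degree p. \<Sum>i\<le>degree (coeff p j). const2 (coeff2 p i j) * a ^ i * b ^ j)"

text \<open>The homogeneous component of degree \<open>d\<close> when the variables have degrees 1 and 2.\<close>

definition whomog :: "nat \<Rightarrow> bipoly set" where
  "whomog d = {p. \<forall>i j. coeff2 p i j \<noteq> 0 \<longrightarrow> i + 2 * j = d}"

record 'a graded_algebra = "(rat, 'a) module" +
  grade :: "nat \<Rightarrow> 'a set"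

text \<open>Scalar multiplication on cosets is defined on representatives, in the same way as
  \<^const>\<open>rcoset_mult\<close>. Without it, \<open>Quot\<close> would only give the quotient ring.\<close>

definition graded_quot :: "('a, 'm) graded_algebra_scheme \<Rightarrow> 'a set \<Rightarrow> 'a set graded_algebra"
    (infixl \<open>GQuot\<close> 65) where
  "A GQuot I =
    \<lparr>carrier = carrier (A Quot I), mult = mult (A Quot I), one = one (A Quot I),
     zero = zero (A Quot I), add = add (A Quot I),
     smult = (\<lambda>c X. \<Union>x\<in>X. I +>\<^bsub>A\<^esub> (c \<odot>\<^bsub>A\<^esub> x)),
     grade = (\<lambda>d. (\<lambda>x. I +>\<^bsub>A\<^esub> x) ` grade A d)\<rparr>"

definition graded_algebra_iso ::
    "('a, 'm) graded_algebra_scheme \<Rightarrow> ('b, 'n) graded_algebra_scheme \<Rightarrow> ('a \<Rightarrow> 'b) set" where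
  "graded_algebra_iso A B =
    {h \<in> ring_iso A B.
       (\<forall>c. \<forall>x\<in>carrier A. h (c \<odot>\<^bsub>A\<^esub> x) = c \<odot>\<^bsub>B\<^esub> h x) \<and>
       (\<forall>d. h ` grade A d = grade B d)}"

definition graded_isomorphic ::
    "('a, 'm) graded_algebra_scheme \<Rightarrow> ('b, 'n) graded_algebra_scheme \<Rightarrow> bool"
    (infix \<open>\<cong>\<^sub>g\<^sub>r\<close> 60) where
  "A \<cong>\<^sub>g\<^sub>r B \<longleftrightarrow> graded_algebra_iso A B \<noteq> {}"

text \<open>The polynomial ring in two indeterminates \<open>e\<^sub>1\<close>, \<open>e\<^sub>2\<close> of degrees 1 and 2.\<close>

definition polyring_e :: "bipoly graded_algebra" where
  "polyring_e =
    \<lparr>carrier = UNIV, mult = (*), one = 1, zero = 0, add = (+),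
     smult = (\<lambda>c p. const2 c * p), grade = whomog\<rparr>"

text \<open>The subalgebra of \<open>\<rat>[x\<^sub>1,x\<^sub>2]\<close> generated by \<open>x\<^sub>1 + x\<^sub>2\<close> and \<open>x\<^sub>1 x\<^sub>2\<close>.\<close>

definition sym_eval :: "bipoly \<Rightarrow> bipoly" where
  "sym_eval p = subst2 p (V1 + V2) (V1 * V2)"

definition symring :: "bipoly graded_algebra" where
  "symring =
    \<lparr>carrier = range sym_eval, mult = (*), one = 1, zero = 0, add = (+),
     smult = (\<lambda>c p. const2 c * p), grade = (\<lambda>d. sym_eval ` whomog d)\<rparr>"

definition e1pow :: "nat \<Rightarrow> bipoly" where
  "e1pow m = V1 ^ m + V2 ^ m"

definition e2pow :: "nat \<Rightarrow> bipoly" where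
  "e2pow m = V1 ^ m * V2 ^ m"

definition A2 :: "nat \<Rightarrow> bipoly set graded_algebra" where
  "A2 m = symring GQuot (Idl\<^bsub>symring\<^esub> {e1pow m, e2pow m})"

text \<open>\<open>\<partial>/\<partial>E\<^sub>1\<close> differentiates the coefficient polynomials, \<open>\<partial>/\<partial>E\<^sub>2\<close> the outer variable; a monomial
  \<open>e\<^sub>1^i e\<^sub>2^j\<close> acts by the corresponding iterated derivative.\<close>

definition D1 :: "bipoly \<Rightarrow> bipoly" where
  "D1 = map_poly pderiv"

definition D2 :: "bipoly \<Rightarrow> bipoly" where
  "D2 = pderiv"

definition diff_act :: "bipoly \<Rightarrow> bipoly \<Rightarrow> bipoly" (infixr \<open>\<circ>\<^sub>D\<close> 75) where
  "f \<circ>\<^sub>D F =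
    (\<Sum>j\<le>degree f. \<Sum>i\<le>degree (coeff f j). const2 (coeff2 f i j) * (D1 ^^ i) ((D2 ^^ j) F))"

definition Ann :: "bipoly \<Rightarrow> bipoly set" where
  "Ann F = {f. f \<circ>\<^sub>D F = 0}"

definition f_poly :: "nat \<Rightarrow> bipoly" where
  "f_poly m =
    (\<Sum>k = 0..m div 2.
       const2 ((-1) ^ k * (of_nat m / of_nat (m - k)) * of_nat ((m - k) choose k))
       * V1 ^ (m - 2 * k) * V2 ^ k)"

definition F_poly :: "nat \<Rightarrow> bipoly" where
  "F_poly m =
    (\<Sum>n = 0..m - 1.
       const2 (of_nat m / of_nat (m + 2 * n) * of_nat ((m + 2 * n) choose n)
               / (fact (m + 2 * n - 1) * fact (m - n - 1)))
       * V1 ^ (m + 2 * n - 1) * V2 ^ (m - n - 1))"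

end

theory Submission
  imports Defs
begin

text \<open>
  The map \<^const>\<open>sym_eval\<close> identifies \<open>\<rat>[e\<^sub>1,e\<^sub>2]\<close> with the ring of symmetric polynomials: a
  nonzero polynomial in the kernel could be divided by \<open>e\<^sub>2\<close>, since setting \<open>x\<^sub>2 = 0\<close> maps \<open>e\<^sub>1\<close> to
  \<open>x\<^sub>1\<close> and \<open>e\<^sub>2\<close> to \<open>0\<close>. The power sums satisfy \<open>p\<^sub>m\<^sub>+\<^sub>2 = e\<^sub>1 p\<^sub>m\<^sub>+\<^sub>1 - e\<^sub>2 p\<^sub>m\<close>, and the closed form
  \<open>f\<^sub>m\<close> satisfies the same recurrence (\<open>f_poly_eq_lucas\<close>, \<open>sym_eval_lucas\<close>). So the two ideals
  correspond, and an isomorphism of graded algebras that matches two ideals induces one of the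
  quotients (\<open>GQuot_graded_isomorphic\<close>).

  In the second part, \<open>\<rat>[e\<^sub>1,e\<^sub>2]\<close> acts on the divided-power monomials \<open>E\<^sub>1^p E\<^sub>2^q / (p! q!)\<close> by
  lowering exponents. In this basis \<open>F\<^sub>m\<close> has as coefficients the numbers
  \<open>m / (m + 2 n) * ((m + 2 n) choose n)\<close>, those of the \<open>m\<close>-th power of the Catalan series \<open>C\<close>.
  The relation \<open>C^j = C^(j-1) + t C^(j+1)\<close> matches the roots \<open>1 / C\<close> and \<open>t C\<close> of
  \<open>z\<^sup>2 - z + t\<close>, whose power sums \<open>f\<^sub>m\<close> describes. Hence \<open>f\<^sub>m\<close> turns the form built from \<open>C^j\<close> into
  the sum of those built from \<open>C^(j-m)\<close> and \<open>t^m C^(j+m)\<close> (\<open>lucas_diff_act_ballot_form\<close>). For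
  \<open>j = m\<close> the first is the constant series \<open>1\<close>, whose only term is lowered to a negative power of \<open>E\<^sub>1\<close>,
  and the second would need a negative power of \<open>E\<^sub>2\<close>; so \<open>f\<^sub>m\<close> annihilates \<open>F\<^sub>m\<close>. So does
  \<open>e\<^sub>2^m\<close>, as \<open>F\<^sub>m\<close> has degree \<open>m - 1\<close> in \<open>E\<^sub>2\<close>.

  Conversely, let \<open>e\<^sub>2^k g\<close> annihilate \<open>F\<^sub>m\<close> with \<open>k < m\<close>. Then so does \<open>e\<^sub>2^(m-1) g\<close>, which says that
  \<open>g\<close> annihilates \<open>E\<^sub>1^(m-1) / (m-1)!\<close>, that is, \<open>g \<equiv> h e\<^sub>1^m\<close> modulo \<open>e\<^sub>2\<close> for some \<open>h\<close> in
  \<open>\<rat>[e\<^sub>1]\<close>. Since \<open>f\<^sub>m \<equiv> e\<^sub>1^m\<close> modulo \<open>e\<^sub>2\<close>, subtracting \<open>e\<^sub>2^k h f\<^sub>m\<close> leaves an annihilator that is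
  divisible by \<open>e\<^sub>2^(k+1)\<close>. After finitely many steps it is divisible by \<open>e\<^sub>2^m\<close>, so
  \<open>Ann(F\<^sub>m)\<close> is generated by \<open>f\<^sub>m\<close> and \<open>e\<^sub>2^m\<close> (\<open>Ann_F_poly_subset\<close>).
\<close>

section \<open>Polynomials in two variables as sums of monomials\<close>

lemma sum_coeff_extend:
  assumes "\<And>i. \<phi> 0 i = 0" "degree p \<le> n"
  shows "(\<Sum>i\<le>degree p. \<phi> (coeff p i) i) = (\<Sum>i\<le>n. \<phi> (coeff p i) i)"
  by (rule sum.mono_neutral_left) (use assms in \<open>auto simp: coeff_eq_0\<close>)

lemma sum_coeff_add:
  fixes \<phi> :: "'a::comm_monoid_add \<Rightarrow> nat \<Rightarrow> 'b::comm_monoid_add"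
  assumes "\<And>i. \<phi> 0 i = 0" "\<And>a b i. \<phi> (a + b) i = \<phi> a i + \<phi> b i"
  shows "(\<Sum>i\<le>degree (p + q). \<phi> (coeff (p + q) i) i) =
         (\<Sum>i\<le>degree p. \<phi> (coeff p i) i) + (\<Sum>i\<le>degree q. \<phi> (coeff q i) i)"
proof -
  define n where "n = max (degree p) (degree q)"
  have "degree p \<le> n" "degree q \<le> n" "degree (p + q) \<le> n"
    by (auto simp: n_def intro: degree_add_le)
  from this[THEN sum_coeff_extend[of \<phi>, OF assms(1)]] show ?thesis
    by (simp only: coeff_add assms(2) sum.distrib)
qed

lemma sum_coeff_monom:
  assumes "\<And>i. \<phi> 0 i = 0"
  shows "(\<Sum>i\<le>degree (monom c n). \<phi> (coeff (monom c n) i) i) = \<phi> c n"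
proof -
  have "(\<Sum>i\<le>degree (monom c n). \<phi> (coeff (monom c n) i) i)
      = (\<Sum>i\<le>n. \<phi> (coeff (monom c n) i) i)"
    by (rule sum_coeff_extend) (auto simp: assms degree_monom_le)
  also have "\<dots> = (\<Sum>i\<le>n. if i = n then \<phi> c n else 0)"
    by (intro sum.cong) (auto simp: assms)
  finally show ?thesis by simp
qed

text \<open>The common shape of \<^const>\<open>subst2\<close> and \<^const>\<open>diff_act\<close>. Their ranges of
  summation depend on the polynomial, which hides that they are additive in it.\<close>

definition bisum :: "(rat \<Rightarrow> nat \<Rightarrow> nat \<Rightarrow> 'b::comm_monoid_add) \<Rightarrow> bipoly \<Rightarrow> 'b" where
  "bisum \<phi> p = (\<Sum>j\<le>degree p. \<Sum>i\<le>degree (coeff p j). \<phi> (coeff2 p i j) i j)"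

lemma bisum_add:
  assumes "\<And>i j. \<phi> 0 i j = 0" "\<And>a b i j. \<phi> (a + b) i j = \<phi> a i j + \<phi> b i j"
  shows "bisum \<phi> (p + q) = bisum \<phi> p + bisum \<phi> q"
proof -
  define \<psi> where "\<psi> c j = (\<Sum>i\<le>degree c. \<phi> (coeff c i) i j)" for c j
  have add: "\<psi> (a + b) j = \<psi> a j + \<psi> b j" for a b j
    unfolding \<psi>_def by (rule sum_coeff_add) (auto simp: assms)
  have "\<psi> 0 j = 0" for j
    by (simp add: \<psi>_def assms)
  from sum_coeff_add[of \<psi>, OF this add] show ?thesis
    by (simp add: bisum_def \<psi>_def coeff2_def)
qed

lemma bisum_monom:
  assumes "\<And>i j. \<phi> 0 i j = 0"
  shows "bisum \<phi> (monom (monom c i) j) = \<phi> c i j"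
proof -
  define \<psi> where "\<psi> c j = (\<Sum>i\<le>degree c. \<phi> (coeff c i) i j)" for c j
  have "\<psi> 0 j = 0" for j
    by (simp add: \<psi>_def assms)
  from sum_coeff_monom[of \<psi>, OF this] have "bisum \<phi> (monom (monom c i) j) = \<psi> (monom c i) j"
    by (simp add: bisum_def \<psi>_def coeff2_def)
  also have "\<dots> = \<phi> c i j"
    unfolding \<psi>_def by (rule sum_coeff_monom) (rule assms)
  finally show ?thesis .
qed

lemma coeff2_add [simp]: "coeff2 (p + q) i j = coeff2 p i j + coeff2 q i j"
  and coeff2_diff [simp]: "coeff2 (p - q) i j = coeff2 p i j - coeff2 q i j"
  and coeff2_0 [simp]: "coeff2 0 i j = 0"
  and coeff2_sum: "coeff2 (\<Sum>k\<in>K. f k) i j = (\<Sum>k\<in>K. coeff2 (f k) i j)"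
  and coeff2_const2_mult [simp]: "coeff2 (const2 c * p) i j = c * coeff2 p i j"
  and coeff2_const2: "coeff2 (const2 c) i j = (if i = 0 \<and> j = 0 then c else 0)"
  and coeff2_V1_mult: "coeff2 (V1 * p) i j = (if i = 0 then 0 else coeff2 p (i - 1) j)"
  and coeff2_V2_mult: "coeff2 (V2 * p) i j = (if j = 0 then 0 else coeff2 p i (j - 1))"
  and coeff2_monom: "coeff2 (monom (monom c k) l) i j = (if k = i \<and> l = j then c else 0)"
  by (auto simp: coeff2_def coeff_sum const2_def V1_def V2_def coeff_pCons' split: if_splits)

lemma bipoly_eqI: "(\<And>i j. coeff2 p i j = coeff2 q i j) \<Longrightarrow> p = q"
  by (intro poly_eqI) (simp add: coeff2_def)

lemma const2_simps [simp]:
  "const2 0 = 0" "const2 1 = 1"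
  by (simp_all add: const2_def one_pCons)

lemma const2_add: "const2 (a + b) = const2 a + const2 b"
  and const2_mult: "const2 (a * b) = const2 a * const2 b"
  by (simp_all add: const2_def)

lemma monom_bipoly: "const2 c * V1 ^ i * V2 ^ j = monom (monom c i) j"
proof -
  have "V2 ^ j = monom 1 j"
    by (simp add: V2_def monom_altdef)
  moreover have "V1 ^ i = [:monom 1 i:]"
    by (induction i) (auto simp: V1_def one_pCons monom_Suc)
  ultimately show ?thesis
    by (simp add: const2_def smult_monom)
qed

text \<open>For additive statements it suffices to check monomials. All the multiplicativity results
  below come from this rule.\<close>

lemma bipoly_induct [case_names monom add]:
  fixes p :: bipoly
  assumes "\<And>c i j. P (monom (monom c i) j)" "\<And>p q. P p \<Longrightarrow> P q \<Longrightarrow> P (p + q)"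
  shows "P p"
proof -
  have sum: "P (\<Sum>k\<le>n. g k)" if "\<And>k. P (g k)" for g :: "nat \<Rightarrow> bipoly" and n
    by (induction n) (auto intro: that assms)
  have "P (monom (\<Sum>i\<le>n. monom (coeff c i) i) j)" for c :: "rat poly" and j n
    by (induction n) (auto intro: assms simp flip: add_monom)
  then have "P (monom c j)" for c j
    by (metis poly_as_sum_of_monoms)
  then have "P (\<Sum>j\<le>degree p. monom (coeff p j) j)"
    by (rule sum)
  then show ?thesis
    by (simp add: poly_as_sum_of_monoms)
qed

section \<open>Symmetric polynomials\<close>

lemma subst2_add: "subst2 (p + q) a b = subst2 p a b + subst2 q a b"
proof -
  have "subst2 p a b = bisum (\<lambda>c i j. const2 c * a ^ i * b ^ j) p" for p
    by (simp add: subst2_def bisum_def)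
  then show ?thesis
    by (simp add: bisum_add const2_add algebra_simps)
qed

lemma subst2_monom: "subst2 (monom (monom c i) j) a b = const2 c * a ^ i * b ^ j"
proof -
  have "subst2 p a b = bisum (\<lambda>c i j. const2 c * a ^ i * b ^ j) p" for p
    by (simp add: subst2_def bisum_def)
  then show ?thesis
    by (simp add: bisum_monom)
qed

lemma subst2_mult: "subst2 (p * q) a b = subst2 p a b * subst2 q a b"
proof (induction p rule: bipoly_induct)
  case (monom c i j)
  show ?case
  proof (induction q rule: bipoly_induct)
    case (monom d k l)
    show ?case
      by (simp add: mult_monom subst2_monom const2_mult power_add)
  qed (simp add: subst2_add algebra_simps)
qed (simp add: subst2_add algebra_simps)

lemma sym_eval_add: "sym_eval (p + q) = sym_eval p + sym_eval q"
  and sym_eval_mult: "sym_eval (p * q) = sym_eval p * sym_eval q"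
  by (simp_all add: sym_eval_def subst2_add subst2_mult)

lemma sym_eval_const2: "sym_eval (const2 c) = const2 c"
  and sym_eval_V1: "sym_eval V1 = V1 + V2"
  and sym_eval_V2: "sym_eval V2 = V1 * V2"
proof -
  have "sym_eval (const2 c * V1 ^ i * V2 ^ j) = const2 c * (V1 + V2) ^ i * (V1 * V2) ^ j" for c i j
    by (simp only: monom_bipoly) (simp only: sym_eval_def subst2_monom)
  from this[of c 0 0] this[of 1 1 0] this[of 1 0 1]
  show "sym_eval (const2 c) = const2 c" "sym_eval V1 = V1 + V2" "sym_eval V2 = V1 * V2"
    by simp_all
qed

lemma sym_eval_0 [simp]: "sym_eval 0 = 0"
  and sym_eval_1 [simp]: "sym_eval 1 = 1"
  using sym_eval_const2[of 0] sym_eval_const2[of 1] by simp_all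

lemma sym_eval_minus: "sym_eval (- p) = - sym_eval p"
  by (metis add_eq_0_iff sym_eval_0 sym_eval_add)

lemma sym_eval_diff: "sym_eval (p - q) = sym_eval p - sym_eval q"
  using sym_eval_add[of p "- q"] by (simp add: sym_eval_minus)

lemma sym_eval_power: "sym_eval (p ^ n) = sym_eval p ^ n"
  by (induction n) (simp_all add: sym_eval_mult)

text \<open>The outer constant coefficient is the value at \<open>x\<^sub>2 = 0\<close>, where \<open>e\<^sub>1\<close> becomes \<open>x\<^sub>1\<close> and
  \<open>e\<^sub>2\<close> vanishes.\<close>

lemma coeff_sym_eval_0: "coeff (sym_eval p) 0 = coeff p 0"
proof (induction p rule: bipoly_induct)
  case (monom c i j)
  have "coeff (V1 ^ i) 0 = monom 1 i" for i
    using monom_bipoly[of 1 i 0] by simp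
  then have "poly (V1 + V2) 0 = monom 1 1" "poly V1 0 = monom 1 1"
    by (simp_all add: V1_def V2_def poly_0_coeff_0 monom_altdef)
  then show ?case
    by (simp add: sym_eval_def subst2_monom const2_def poly_0_coeff_0[symmetric] monom_power V2_def
        poly_monom smult_monom power_0_left)
qed (simp add: sym_eval_add)

lemma V2_mult_pCons: "V2 * p = pCons 0 p"
  by (simp add: V2_def)

text \<open>Algebraic independence of \<open>x\<^sub>1 + x\<^sub>2\<close> and \<open>x\<^sub>1 x\<^sub>2\<close>: at \<open>x\<^sub>2 = 0\<close> the relation shows that \<open>p\<close>
  has no part free of \<open>e\<^sub>2\<close>; then \<open>x\<^sub>1 x\<^sub>2\<close> cancels and the quotient of \<open>p\<close> by \<open>e\<^sub>2\<close> is
  again a relation.\<close>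

lemma sym_eval_eq_0: "sym_eval p = 0 \<Longrightarrow> p = 0"
proof (induction p)
  case (pCons c p)
  have "c = 0"
    using coeff_sym_eval_0[of "pCons c p"] pCons.prems by simp
  then have "sym_eval (pCons c p) = (V1 * V2) * sym_eval p"
    by (simp flip: V2_mult_pCons add: sym_eval_mult sym_eval_V2)
  moreover have "V1 * V2 \<noteq> 0"
    by (simp add: V1_def V2_def)
  ultimately have "p = 0"
    using pCons by simp
  then show ?case
    using \<open>c = 0\<close> by simp
qed simp

lemma inj_sym_eval: "inj sym_eval"
  by (rule injI) (metis eq_iff_diff_eq_0 sym_eval_diff sym_eval_eq_0)

section \<open>The action by differentiation\<close>

lemma coeff2_D1: "coeff2 (D1 F) i j = of_nat (Suc i) * coeff2 F (Suc i) j"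
  by (simp add: coeff2_def D1_def coeff_map_poly coeff_pderiv)

lemma coeff2_D2: "coeff2 (D2 F) i j = of_nat (Suc j) * coeff2 F i (Suc j)"
proof -
  have *: "(of_nat n :: rat poly) * p = Polynomial.smult (of_nat n) p" for n p
    by (simp add: of_nat_poly)
  then show ?thesis
    unfolding coeff2_def D2_def coeff_pderiv * by (simp del: of_nat_Suc)
qed

lemma D_linear:
  "D1 (F + G) = D1 F + D1 G" "D1 (const2 c * F) = const2 c * D1 F"
  "D2 (F + G) = D2 F + D2 G" "D2 (const2 c * F) = const2 c * D2 F"
  by (rule bipoly_eqI, simp add: coeff2_D1 coeff2_D2 distrib_left)+

lemma D_commute: "D1 (D2 F) = D2 (D1 F)"
  by (rule bipoly_eqI) (simp add: coeff2_D1 coeff2_D2)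

lemma D_pow_linear:
  "(D1 ^^ i) (F + G) = (D1 ^^ i) F + (D1 ^^ i) G" "(D1 ^^ i) (const2 c * F) = const2 c * (D1 ^^ i) F"
  "(D2 ^^ i) (F + G) = (D2 ^^ i) F + (D2 ^^ i) G" "(D2 ^^ i) (const2 c * F) = const2 c * (D2 ^^ i) F"
  by (induction i) (simp_all add: D_linear)

lemma D_pow_commute: "(D1 ^^ i) ((D2 ^^ j) F) = (D2 ^^ j) ((D1 ^^ i) F)"
proof -
  have *: "D1 ((D2 ^^ j) F) = (D2 ^^ j) (D1 F)" for F
    by (induction j) (simp_all add: D_commute)
  show ?thesis
    by (induction i) (simp_all add: *)
qed

lemma diff_act_bisum: "f \<circ>\<^sub>D F = bisum (\<lambda>c i j. const2 c * (D1 ^^ i) ((D2 ^^ j) F)) f"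
  by (simp add: diff_act_def bisum_def)

lemma diff_act_monom: "monom (monom c i) j \<circ>\<^sub>D F = const2 c * (D1 ^^ i) ((D2 ^^ j) F)"
  by (simp add: diff_act_bisum bisum_monom)

lemma diff_act_add_left: "(f + g) \<circ>\<^sub>D F = f \<circ>\<^sub>D F + g \<circ>\<^sub>D F"
  by (simp add: diff_act_bisum bisum_add const2_add algebra_simps)

lemma diff_act_add_right: "f \<circ>\<^sub>D (F + G) = f \<circ>\<^sub>D F + f \<circ>\<^sub>D G"
  by (induction f rule: bipoly_induct)
    (simp_all add: diff_act_monom diff_act_add_left D_pow_linear algebra_simps)

text \<open>Polynomials act as a module because the two partial derivatives commute.\<close>

lemma diff_act_mult: "(f * g) \<circ>\<^sub>D F = f \<circ>\<^sub>D (g \<circ>\<^sub>D F)"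
proof (induction f rule: bipoly_induct)
  case (monom c i j)
  show ?case
  proof (induction g rule: bipoly_induct)
    case (monom d k l)
    have "(D1 ^^ (i + k)) ((D2 ^^ (j + l)) F) = (D1 ^^ i) ((D2 ^^ j) ((D1 ^^ k) ((D2 ^^ l) F)))"
      by (simp add: funpow_add D_pow_commute)
    then show ?case
      by (simp add: mult_monom diff_act_monom D_pow_linear const2_mult algebra_simps)
  qed (simp add: diff_act_add_left diff_act_add_right algebra_simps)
qed (simp add: diff_act_add_left diff_act_add_right algebra_simps)

lemma diff_act_generators:
  "const2 c \<circ>\<^sub>D F = const2 c * F" "V1 \<circ>\<^sub>D F = D1 F" "V2 \<circ>\<^sub>D F = D2 F"
proof -
  have "(const2 c * V1 ^ i * V2 ^ j) \<circ>\<^sub>D F = const2 c * (D1 ^^ i) ((D2 ^^ j) F)" for c i j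
    unfolding monom_bipoly by (rule diff_act_monom)
  from this[of c 0 0] this[of 1 1 0] this[of 1 0 1]
  show "const2 c \<circ>\<^sub>D F = const2 c * F" "V1 \<circ>\<^sub>D F = D1 F" "V2 \<circ>\<^sub>D F = D2 F"
    by simp_all
qed

lemma diff_act_0 [simp]: "0 \<circ>\<^sub>D F = 0" "f \<circ>\<^sub>D 0 = 0"
  using diff_act_add_left[of 0 0 F] diff_act_add_right[of f 0 0] by simp_all

lemma diff_act_minus_left: "(- f) \<circ>\<^sub>D F = - (f \<circ>\<^sub>D F)"
  by (metis add_eq_0_iff diff_act_0(1) diff_act_add_left)

lemma diff_act_diff_left: "(f - g) \<circ>\<^sub>D F = f \<circ>\<^sub>D F - g \<circ>\<^sub>D F"
  using diff_act_add_left[of f "- g" F] by (simp add: diff_act_minus_left)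

lemma diff_act_V2_power: "V2 ^ n \<circ>\<^sub>D F = (D2 ^^ n) F"
proof (induction n)
  case 0
  show ?case
    using diff_act_generators(1)[of 1 F] by simp
qed (simp add: diff_act_mult diff_act_generators)

section \<open>Power sums in terms of elementary symmetric polynomials\<close>

text \<open>The bivariate Lucas polynomials, which express the power sums through \<open>e\<^sub>1\<close> and
  \<open>e\<^sub>2\<close>. They agree with \<^const>\<open>f_poly\<close> except at \<open>0\<close>, where the power sum is \<open>2\<close> while
  the factor \<open>m / (m - k)\<close> of the closed form is \<open>0 / 0 = 0\<close>.\<close>

fun lucas :: "nat \<Rightarrow> bipoly" where
  "lucas 0 = 2"
| "lucas (Suc 0) = V1"
| "lucas (Suc (Suc m)) = V1 * lucas (Suc m) - V2 * lucas m"

lemma sym_eval_lucas: "sym_eval (lucas m) = e1pow m"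
proof (induction m rule: lucas.induct)
  case 1
  have "sym_eval 2 = sym_eval (1 + 1)"
    by simp
  also have "\<dots> = 1 + 1"
    by (simp only: sym_eval_add sym_eval_1)
  finally show ?case
    by (simp add: e1pow_def)
qed (simp_all add: sym_eval_diff sym_eval_mult sym_eval_V1 sym_eval_V2 e1pow_def algebra_simps)

text \<open>The coefficient of \<open>e\<^sub>1^i e\<^sub>2^j\<close>, indexed by the exponents so that no subtraction of naturals
  occurs; the degree of the power sum is \<open>m = i + 2 j\<close>.\<close>

definition lucas_coeff :: "nat \<Rightarrow> nat \<Rightarrow> rat" where
  "lucas_coeff i j = (if i = 0 \<and> j = 0 then 2
     else (-1) ^ j * (of_nat (i + 2 * j) / of_nat (i + j)) * of_nat ((i + j) choose j))"

lemma lucas_coeff_rec: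
  "lucas_coeff (Suc i) (Suc j) = lucas_coeff i (Suc j) - lucas_coeff (Suc i) j"
proof -
  (* By Pascal's rule and absorption, the three binomial coefficients are rational multiples of y. *)
  define s :: rat where "s = (-1) ^ j"
  define n where "n = i + j"
  define x y z where "x = (of_nat ((n + 2) choose (j + 1)) :: rat)"
    and "y = (of_nat ((n + 1) choose (j + 1)) :: rat)" and "z = (of_nat ((n + 1) choose j) :: rat)"
  have xyz: "x = y + z"
    by (simp add: x_def y_def z_def)
  have "Suc j * (Suc n choose Suc j) = (Suc n - j) * (Suc n choose j)"
    unfolding n_def by (metis binomial_absorb_comp binomial_absorption diff_Suc_1)
  then have "(of_nat (Suc j * (Suc n choose Suc j)) :: rat) = of_nat ((Suc i) * (Suc n choose j))"
    by (simp add: n_def Suc_diff_le)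
  then have yz: "(of_nat j + 1) * y = (of_nat i + 1) * z"
    unfolding y_def z_def of_nat_mult by (simp add: algebra_simps)
  define a b :: rat where "a = of_nat i" and "b = of_nat j"
  have ab: "a \<ge> 0" "b \<ge> 0"
    by (simp_all add: a_def b_def)
  have z_eq: "z = (b + 1) * y / (a + 1)"
    using yz ab by (simp add: a_def b_def field_simps)
  have 1: "lucas_coeff (Suc i) (Suc j) = - s * ((a + 2 * b + 3) / (a + b + 2)) * x"
    by (simp add: lucas_coeff_def s_def x_def a_def b_def n_def algebra_simps)
  have 2: "lucas_coeff i (Suc j) = - s * ((a + 2 * b + 2) / (a + b + 1)) * y"
    by (simp add: lucas_coeff_def s_def y_def a_def b_def n_def algebra_simps)
  have 3: "lucas_coeff (Suc i) j = s * ((a + 2 * b + 1) / (a + b + 1)) * z"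
    by (simp add: lucas_coeff_def s_def z_def a_def b_def n_def algebra_simps)
  have scale: "- s * u * x = - s * v * y - s * w * z" if "u * x = v * y + w * z" for u v w
    using arg_cong[OF that, of "(*) (- s)"] by (simp add: algebra_simps)
  have "(a + 2 * b + 3) / (a + b + 2) * x = (a + 2 * b + 2) / (a + b + 1) * y + (a + 2 * b + 1) / (a + b + 1) * z"
    unfolding xyz z_eq using ab by (simp add: divide_simps) (simp add: algebra_simps)
  then show ?thesis
    unfolding 1 2 3 by (rule scale)
qed

lemma coeff2_lucas: "coeff2 (lucas m) i j = (if i + 2 * j = m then lucas_coeff i j else 0)"
proof (induction m arbitrary: i j rule: lucas.induct)
  case 1
  have two: "(2 :: bipoly) = const2 2"
    by (simp add: const2_def numeral_poly)
  show ?case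
    unfolding lucas.simps two coeff2_const2 by (simp add: lucas_coeff_def)
next
  case 2
  have V1_monom: "V1 = monom (monom 1 1) 0"
    using monom_bipoly[of 1 1 0] by simp
  show ?case
    unfolding lucas.simps V1_monom coeff2_monom by (auto simp: lucas_coeff_def)
next
  case (3 m)
  have i0: "lucas_coeff i 0 = 1" if "i > 0" for i
    using that by (simp add: lucas_coeff_def)
  have j0: "lucas_coeff 0 (Suc j) = - lucas_coeff 0 j" for j
    by (cases "j = 0") (auto simp: lucas_coeff_def field_simps)
  show ?case
  proof (cases i; cases j)
    fix i' j'
    assume "i = Suc i'" "j = Suc j'"
    then show ?thesis
      by (auto simp: coeff2_V1_mult coeff2_V2_mult 3 lucas_coeff_rec)
  qed (auto simp: coeff2_V1_mult coeff2_V2_mult 3 i0 j0)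
qed

text \<open>The Girard--Waring formula.\<close>

lemma f_poly_eq_lucas:
  assumes "m \<ge> 1"
  shows "f_poly m = lucas m"
proof (rule bipoly_eqI)
  fix i j
  have "coeff2 (f_poly m) i j = (\<Sum>k = 0..m div 2. if k = j then (if i + 2 * j = m then lucas_coeff i j else 0) else 0)"
    unfolding f_poly_def coeff2_sum monom_bipoly coeff2_monom
  proof (rule sum.cong, goal_cases)
    case (2 k)
    have "(if m - 2 * k = i \<and> k = j then (-1) ^ k * (of_nat m / of_nat (m - k)) * of_nat ((m - k) choose k) else 0)
      = (if i + 2 * j = m then lucas_coeff i j else 0)" if "k = j"
    proof -
      have "m - 2 * k = i \<longleftrightarrow> i + 2 * j = m"
        using 2 that by auto
      then show ?thesis
        using that assms by (auto simp: lucas_coeff_def)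
    qed
    then show ?case
      by simp
  qed simp
  also have "\<dots> = (if i + 2 * j = m then lucas_coeff i j else 0)"
    by auto
  finally show "coeff2 (f_poly m) i j = coeff2 (lucas m) i j"
    by (simp add: coeff2_lucas)
qed

lemma coeff_lucas_0: "coeff (lucas (Suc m)) 0 = monom 1 (Suc m)"
proof (induction m)
  case (Suc m)
  then show ?case
    by (simp add: V1_def V2_mult_pCons monom_Suc)
qed (simp add: V1_def monom_Suc)

section \<open>Ballot numbers and the form annihilated by the power sums\<close>

text \<open>Divided-power monomials \<open>E\<^sub>1^p E\<^sub>2^q / (p! q!)\<close>, on which both derivatives act as
  shifts. The first exponent is an integer, with value \<open>0\<close> for negative ones, so that
  \<open>\<partial>/\<partial>E\<^sub>1\<close> always lowers it by one.\<close>

definition dpow :: "int \<Rightarrow> nat \<Rightarrow> bipoly" where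
  "dpow p q = (if p < 0 then 0 else monom (monom (1 / (fact (nat p) * fact q)) (nat p)) q)"

lemma coeff2_dpow: "coeff2 (dpow p q) i j = (if int i = p \<and> j = q then 1 / (fact i * fact j) else 0)"
  by (auto simp: dpow_def coeff2_monom)

lemma fact_Suc_cancel:
  "of_nat (Suc n) / (fact (Suc n) * c) = (1 / (fact n * c) :: rat)"
  "of_nat (Suc n) / (c * fact (Suc n)) = (1 / (c * fact n) :: rat)"
  by (simp_all add: fact_Suc del: of_nat_Suc)

lemma D1_dpow: "D1 (dpow p q) = dpow (p - 1) q"
  by (rule bipoly_eqI) (auto simp: coeff2_D1 coeff2_dpow fact_Suc_cancel simp del: of_nat_Suc fact_Suc)

lemma D2_dpow: "D2 (dpow p q) = (case q of 0 \<Rightarrow> 0 | Suc q' \<Rightarrow> dpow p q')"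
  by (rule bipoly_eqI) (auto simp: coeff2_D2 coeff2_dpow fact_Suc_cancel
      simp del: of_nat_Suc fact_Suc split: nat.splits)

text \<open>The coefficient of \<open>t^n\<close> in the \<open>j\<close>-th power of the Catalan series \<open>C = 1 + t C\<^sup>2\<close>. Written as
  a difference of binomial coefficients, it satisfies the relation \<open>C^(j+1) = C^j + t C^(j+2)\<close> by
  Pascal's rule alone, and it is also right for \<open>j = n = 0\<close>, where the quotient formula
  would be \<open>0 / 0\<close>.\<close>

fun ballot :: "nat \<Rightarrow> nat \<Rightarrow> rat" where
  "ballot j 0 = 1"
| "ballot j (Suc n) = of_nat ((j + 2 * n + 1) choose Suc n) - of_nat ((j + 2 * n + 1) choose n)"

lemma ballot_rec: "ballot (Suc j) (Suc n) = ballot j (Suc n) + ballot (Suc (Suc j)) n"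
  by (cases n) (simp_all add: algebra_simps)

lemma ballot_0: "ballot 0 (Suc n) = 0"
  using binomial_symmetric[of n "2 * n + 1"] by simp

lemma ballot_closed_form:
  assumes "j \<ge> 1"
  shows "ballot j n = of_nat j / of_nat (j + 2 * n) * of_nat ((j + 2 * n) choose n)"
proof (cases n)
  case (Suc k)
  define N where "N = j + 2 * k + 1"
  define x y z where "x = (of_nat (N choose Suc k) :: rat)" and "y = (of_nat (N choose k) :: rat)"
    and "z = (of_nat (Suc N choose Suc k) :: rat)"
  have xyz: "z = x + y"
    by (simp add: x_def y_def z_def)
  have "of_nat (Suc k * (Suc N choose Suc k)) = (of_nat (Suc N * (N choose k)) :: rat)"
    by (metis Suc_times_binomial)
  then have "(of_nat k + 1) * z = (of_nat N + 1) * y"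
    unfolding y_def z_def of_nat_mult by (simp add: algebra_simps)
  moreover have N: "of_nat N = (of_nat j + 2 * of_nat k + 1 :: rat)"
    by (simp add: N_def)
  have "(x - y) * (of_nat j + 2 * of_nat k + 2) = (of_nat N + 1) * z - 2 * ((of_nat N + 1) * y)"
    unfolding xyz N by (simp add: algebra_simps)
  ultimately have "(x - y) * (of_nat j + 2 * of_nat k + 2) = of_nat j * z"
    by (simp add: N flip: \<open>(of_nat k + 1) * z = _\<close>) (simp add: algebra_simps)
  moreover have "of_nat j + 2 * of_nat k + 2 \<noteq> (0 :: rat)"
    by (metis add_2_eq_Suc' nat.distinct(1) of_nat_Suc of_nat_add of_nat_eq_0_iff of_nat_mult of_nat_numeral)
  ultimately have "x - y = of_nat j / (of_nat j + 2 * of_nat k + 2) * z"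
    by (simp add: field_simps)
  then show ?thesis
    by (simp add: Suc x_def y_def z_def N_def algebra_simps)
qed (use assms in simp)

text \<open>The form that represents \<open>C^j\<close>, with \<open>r\<close> terms and starting at \<open>E\<^sub>1^s E\<^sub>2^(r-1)\<close>; a factor \<open>t\<close>
  corresponds to the step from \<open>(s, r)\<close> to \<open>(s + 2, r - 1)\<close>. All terms have weight
  \<open>s + 2 (r - 1)\<close>, and \<^const>\<open>F_poly\<close> is the case \<open>j = r = m\<close>, \<open>s = m - 1\<close>.\<close>

definition ballot_form :: "nat \<Rightarrow> int \<Rightarrow> nat \<Rightarrow> bipoly" where
  "ballot_form j s r = (\<Sum>n<r. const2 (ballot j n) * dpow (s + 2 * int n) (r - 1 - n))"

lemma D1_0 [simp]: "D1 0 = 0" and D2_0 [simp]: "D2 0 = 0"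
  by (simp_all add: D1_def D2_def)

lemma D1_sum: "D1 (\<Sum>x\<in>X. g x) = (\<Sum>x\<in>X. D1 (g x))"
  and D2_sum: "D2 (\<Sum>x\<in>X. g x) = (\<Sum>x\<in>X. D2 (g x))"
  by (induction X rule: infinite_finite_induct) (simp_all add: D_linear)

lemma D1_ballot_form: "D1 (ballot_form j s r) = ballot_form j (s - 1) r"
  by (simp add: ballot_form_def D1_sum D_linear D1_dpow algebra_simps)

lemma D2_ballot_form: "D2 (ballot_form j s r) = ballot_form j s (r - 1)"
proof (cases r)
  case (Suc r')
  have "(\<Sum>n<r'. const2 (ballot j n) * D2 (dpow (s + 2 * int n) (r' - n)))
      = (\<Sum>n<r'. const2 (ballot j n) * dpow (s + 2 * int n) (r' - 1 - n))"
  proof (intro sum.cong, goal_cases)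
    case (2 n)
    then have "r' - n = Suc (r' - 1 - n)"
      by auto
    then show ?case
      by (simp add: D2_dpow)
  qed simp
  then show ?thesis
    by (simp add: ballot_form_def Suc D2_sum D_linear D2_dpow)
qed (simp add: ballot_form_def)

lemma ballot_form_rec: "ballot_form (Suc j) s r = ballot_form j s r + ballot_form (Suc (Suc j)) (s + 2) (r - 1)"
proof (cases r)
  case (Suc r')
  have *: "ballot_form j s r = const2 1 * dpow s r'
      + (\<Sum>n<r'. const2 (ballot j (Suc n)) * dpow (s + 2 + 2 * int n) (r' - 1 - n))" for j
    unfolding ballot_form_def Suc by (subst sum.lessThan_Suc_shift) (simp add: algebra_simps)
  show ?thesis
    unfolding * ballot_rec const2_add distrib_right sum.distrib
    by (simp add: ballot_form_def Suc)
qed (simp add: ballot_form_def)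

text \<open>Both sides obey the Lucas recurrence in \<open>m\<close>: the two forms on the right correspond to the
  powers of the roots \<open>1 / C\<close> and \<open>t C\<close> of \<open>z\<^sup>2 - z + t\<close>. Each induction step is one use of
  \<open>ballot_form_rec\<close> for each of them.\<close>

lemma lucas_diff_act_ballot_form:
  assumes "m \<le> j"
  shows "lucas m \<circ>\<^sub>D ballot_form j s r = ballot_form (j - m) (s - int m) r + ballot_form (j + m) (s + int m) (r - m)"
  using assms
proof (induction m rule: lucas.induct)
  case 1
  have "(2 :: bipoly) = const2 1 + const2 1"
    by simp
  then show ?case
    by (simp only: lucas.simps diff_act_add_left diff_act_generators) simp
next
  case 2
  then obtain j' where "j = Suc j'"
    by (metis One_nat_def Suc_le_D)
  then show ?case
    using ballot_form_rec[of j' "s - 1" r] by (simp add: diff_act_generators D1_ballot_form add.commute)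
next
  case (3 m)
  define k where "k = j - Suc (Suc m)"
  have j: "j = k + Suc (Suc m)"
    using 3 by (simp add: k_def)
  have "lucas (Suc (Suc m)) \<circ>\<^sub>D ballot_form j s r
      = D1 (lucas (Suc m) \<circ>\<^sub>D ballot_form j s r) - D2 (lucas m \<circ>\<^sub>D ballot_form j s r)"
    by (simp add: diff_act_diff_left diff_act_mult diff_act_generators)
  also have "\<dots> = ballot_form (Suc k) (s - int m - 2) r + ballot_form (Suc (j + m)) (s + int m) (r - Suc m)
      - ballot_form (Suc (Suc k)) (s - int m) (r - 1) - ballot_form (j + m) (s + int m) (r - Suc m)"
    using 3 by (simp add: D_linear D1_ballot_form D2_ballot_form j algebra_simps Suc_diff_le)
  also have "\<dots> = ballot_form k (s - int m - 2) r + ballot_form (Suc (Suc (j + m))) (s + int m + 2) (r - Suc (Suc m))"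
    using ballot_form_rec[of k "s - int m - 2" r] ballot_form_rec[of "j + m" "s + int m" "r - Suc m"]
    by (simp add: algebra_simps)
  finally show ?case
    by (simp add: k_def algebra_simps)
qed

lemma F_poly_eq_ballot_form:
  assumes "m \<ge> 1"
  shows "F_poly m = ballot_form m (int m - 1) m"
proof -
  have "{0..m - 1} = {..<m}"
    using assms by auto
  then show ?thesis
    unfolding F_poly_def ballot_form_def
  proof (intro sum.cong, goal_cases)
    case (2 n)
    have "nat (int m - 1 + 2 * int n) = m + 2 * n - 1" "\<not> int m - 1 + 2 * int n < 0"
      using assms by auto
    then show ?case
      unfolding dpow_def monom_bipoly ballot_closed_form[OF assms]
      by (simp add: const2_def smult_monom)
  qed
qed

text \<open>The two forms on the right of \<open>lucas_diff_act_ballot_form\<close> vanish at the ends of the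
  range: \<open>C^0 = 1\<close> contributes only its first term, of exponent \<open>-1\<close> in \<open>E\<^sub>1\<close>, and the
  form for \<open>C^(2m)\<close> has no terms left.\<close>

lemma f_poly_diff_act_F_poly:
  assumes "m \<ge> 1"
  shows "f_poly m \<circ>\<^sub>D F_poly m = 0"
proof -
  have "ballot_form 0 (-1) m = 0"
    unfolding ballot_form_def
  proof (rule sum.neutral, safe)
    fix n
    show "const2 (ballot 0 n) * dpow (- 1 + 2 * int n) (m - 1 - n) = 0"
      by (cases n) (simp_all add: dpow_def ballot_0 del: ballot.simps(2))
  qed
  moreover have "ballot_form (m + m) s 0 = 0" for s
    by (simp add: ballot_form_def)
  ultimately show ?thesis
    by (simp add: f_poly_eq_lucas[OF assms] F_poly_eq_ballot_form[OF assms] lucas_diff_act_ballot_form)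
qed

lemma D2_power_ballot_form: "(D2 ^^ n) (ballot_form j s r) = ballot_form j s (r - n)"
  by (induction n) (simp_all add: D2_ballot_form)

lemma V2_power_diff_act_F_poly:
  assumes "m \<ge> 1"
  shows "V2 ^ n \<circ>\<^sub>D F_poly m = ballot_form m (int m - 1) (m - n)"
  by (simp add: diff_act_V2_power F_poly_eq_ballot_form[OF assms] D2_power_ballot_form)

section \<open>The annihilator\<close>

text \<open>Acting on a divided power of \<open>E\<^sub>1\<close> alone reads off, up to factorials, the low coefficients
  of the part of \<open>g\<close> free of \<open>e\<^sub>2\<close>.\<close>

lemma monom_dvd_if_diff_act_dpow:
  assumes "g \<circ>\<^sub>D dpow (int m - 1) 0 = 0"
  shows "monom 1 m dvd coeff g 0"
proof -
  have "coeff2 (g \<circ>\<^sub>D dpow p 0) k 0 = (if p < int k then 0 else coeff2 g (nat p - k) 0 / fact k)" for p k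
  proof (induction g rule: bipoly_induct)
    case (monom c i j)
    have D1: "(D1 ^^ i) (dpow p q) = dpow (p - int i) q" for p q
      by (induction i) (simp_all add: D1_dpow algebra_simps)
    have D1_zero: "(D1 ^^ i) 0 = 0"
      by (induction i) simp_all
    have D2: "(D2 ^^ j) (dpow p 0) = (if j = 0 then dpow p 0 else 0)"
      by (induction j) (simp_all add: D2_dpow)
    show ?case
      by (cases "j = 0") (auto simp: D1_zero diff_act_monom D2 D1 coeff2_dpow coeff2_monom)
  qed (simp_all add: diff_act_add_left add_divide_distrib)
  note * = this[of "int m - 1"]
  have "coeff (coeff g 0) k = 0" if "k < m" for k
    using *[of "m - 1 - k"] assms that by (auto simp: coeff2_def nat_diff_distrib)
  then show ?thesis
    by (simp add: monom_1_dvd_iff')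
qed

lemma V2_factor_if_coeff_0: "coeff g 0 = 0 \<Longrightarrow> \<exists>g'. g = V2 * g'"
  by (metis V2_mult_pCons pCons_cases coeff_pCons_0)

lemma Ann_closed:
  "f \<in> Ann F \<Longrightarrow> g \<in> Ann F \<Longrightarrow> f - g \<in> Ann F" "g \<in> Ann F \<Longrightarrow> f * g \<in> Ann F"
  by (simp_all add: Ann_def diff_act_diff_left diff_act_mult)

text \<open>An annihilator is reduced by multiples of \<open>f\<^sub>m\<close> to one divisible by a higher power of
  \<open>e\<^sub>2\<close>, until \<open>e\<^sub>2^m\<close> divides it; hence the downward induction on that power. The step works because
  \<open>e\<^sub>2^(m-1)\<close> sends \<open>F\<^sub>m\<close> to \<open>E\<^sub>1^(m-1) / (m-1)!\<close>, while \<open>f\<^sub>m\<close> is \<open>e\<^sub>1^m\<close> modulo \<open>e\<^sub>2\<close>.\<close>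

lemma Ann_F_poly_subset:
  assumes "m \<ge> 1" "g \<in> Ann (F_poly m)"
    and closed: "\<And>a b. a \<in> I \<Longrightarrow> b \<in> I \<Longrightarrow> a + b \<in> I" "\<And>a b. b \<in> I \<Longrightarrow> a * b \<in> I"
    and gens: "f_poly m \<in> I" "V2 ^ m \<in> I"
  shows "g \<in> I"
proof -
  have "V2 ^ k * g \<in> Ann (F_poly m) \<Longrightarrow> V2 ^ k * g \<in> I" if "k \<le> m" for k g
    using that
  proof (induction k arbitrary: g rule: inc_induct)
    case base
    then show ?case
      using closed(2)[of "V2 ^ m" g] gens by (simp add: mult.commute)
  next
    case (step k)
    have "g \<circ>\<^sub>D dpow (int m - 1) 0 = g \<circ>\<^sub>D (V2 ^ (m - 1) \<circ>\<^sub>D F_poly m)"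
      using assms(1) by (simp add: V2_power_diff_act_F_poly ballot_form_def)
    also have "\<dots> = (V2 ^ (m - 1 - k) * (V2 ^ k * g)) \<circ>\<^sub>D F_poly m"
    proof -
      have "V2 ^ (m - 1) = V2 ^ (m - 1 - k) * V2 ^ k"
        using step.hyps by (simp flip: power_add)
      then show ?thesis
        by (simp flip: diff_act_mult add: mult_ac)
    qed
    also have "\<dots> = 0"
      using step.prems Ann_closed(2)[of "V2 ^ k * g"] by (simp add: Ann_def)
    finally obtain h where h: "coeff g 0 = monom 1 m * h"
      using monom_dvd_if_diff_act_dpow by (metis dvdE)
    have f0: "coeff (f_poly m) 0 = monom 1 m"
      using assms(1) coeff_lucas_0[of "m - 1"] by (simp add: f_poly_eq_lucas)
    have "coeff (g - [:h:] * f_poly m) 0 = 0"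
      by (simp add: h f0)
    then obtain g' where g': "g - [:h:] * f_poly m = V2 * g'"
      using V2_factor_if_coeff_0 by blast
    have g: "V2 ^ k * g = V2 ^ Suc k * g' + V2 ^ k * [:h:] * f_poly m"
      using g' by (simp add: algebra_simps)
    have "f_poly m \<in> Ann (F_poly m)"
      using f_poly_diff_act_F_poly assms(1) by (simp add: Ann_def)
    then have "V2 ^ k * g - V2 ^ k * [:h:] * f_poly m \<in> Ann (F_poly m)"
      by (intro Ann_closed step.prems)
    then have "V2 ^ Suc k * g' \<in> I"
      by (intro step.IH) (simp add: g)
    from closed(1)[OF this closed(2)[OF gens(1), of "V2 ^ k * [:h:]"]] show ?case
      by (simp only: g)
  qed
  from this[of 0 g] assms(2) show ?thesis
    by simp
qed

section \<open>Isomorphisms of graded quotients\<close>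

lemma (in ring_hom_ring) ideal_image:
  assumes "ideal I R" "h ` carrier R = carrier S"
  shows "ideal (h ` I) S"
proof (rule idealI)
  interpret I: ideal I R by fact
  show "ring S"
    by (rule S.ring_axioms)
  show "subgroup (h ` I) (add_monoid S)"
    by (intro img_is_add_subgroup I.a_subgroup)
  fix a x
  assume "a \<in> h ` I" "x \<in> carrier S"
  then obtain b y where b_y: "b \<in> I" "a = h b" "y \<in> carrier R" "x = h y"
    using assms(2) by (metis imageE)
  then have "x \<otimes>\<^bsub>S\<^esub> a = h (y \<otimes>\<^bsub>R\<^esub> b)" "a \<otimes>\<^bsub>S\<^esub> x = h (b \<otimes>\<^bsub>R\<^esub> y)"
    using I.Icarr by simp_all
  then show "x \<otimes>\<^bsub>S\<^esub> a \<in> h ` I" "a \<otimes>\<^bsub>S\<^esub> x \<in> h ` I"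
    using b_y(1,3) I.I_l_closed I.I_r_closed by (auto simp del: hom_mult)
qed

lemma ring_iso_image_Idl:
  assumes "ring A" "ring B" "h \<in> ring_iso A B" "S \<subseteq> carrier A"
  shows "h ` (Idl\<^bsub>A\<^esub> S) = Idl\<^bsub>B\<^esub> (h ` S)"
proof -
  have hom: "h \<in> ring_hom A B" and bij: "bij_betw h (carrier A) (carrier B)"
    using assms(3) by (auto simp: ring_iso_def)
  interpret A: ring A by fact
  interpret B: ring B by fact
  interpret h: ring_hom_ring A B h
    by unfold_locales (rule hom)
  have surj: "h ` carrier A = carrier B"
    using bij by (simp add: bij_betw_def)
  have "ideal (h ` (Idl\<^bsub>A\<^esub> S)) B"
    by (intro h.ideal_image A.genideal_ideal assms surj)
  moreover have "h ` S \<subseteq> h ` (Idl\<^bsub>A\<^esub> S)"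
    using A.genideal_self[OF assms(4)] by blast
  ultimately have "Idl\<^bsub>B\<^esub> (h ` S) \<subseteq> h ` (Idl\<^bsub>A\<^esub> S)"
    by (rule B.genideal_minimal)
  moreover have "Idl\<^bsub>A\<^esub> S \<subseteq> {x \<in> carrier A. h x \<in> Idl\<^bsub>B\<^esub> (h ` S)}"
  proof (rule A.genideal_minimal)
    have hS: "h ` S \<subseteq> carrier B"
      using assms(4) surj by blast
    then show "ideal {x \<in> carrier A. h x \<in> Idl\<^bsub>B\<^esub> (h ` S)} A"
      by (intro h.ideal_vimage B.genideal_ideal)
    show "S \<subseteq> {x \<in> carrier A. h x \<in> Idl\<^bsub>B\<^esub> (h ` S)}"
      using assms(4) B.genideal_self[OF hS] by blast
  qed
  ultimately show ?thesis
    by blast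
qed

text \<open>The isomorphism maps each coset to its image as a set. The scalar product of a coset
  is a union over its representatives, and taking images commutes with unions.\<close>

lemma GQuot_graded_isomorphic:
  assumes "ring A" "ring B" and iso: "h \<in> graded_algebra_iso A B"
    and I: "ideal I A" "ideal (h ` I) B"
    and smult: "\<And>c x. x \<in> carrier A \<Longrightarrow> c \<odot>\<^bsub>A\<^esub> x \<in> carrier A"
    and grade: "\<And>d. grade A d \<subseteq> carrier A"
  shows "A GQuot I \<cong>\<^sub>g\<^sub>r B GQuot (h ` I)"
proof -
  have hom: "h \<in> ring_hom A B" and bij: "bij_betw h (carrier A) (carrier B)"
    and h_smult: "\<And>c x. x \<in> carrier A \<Longrightarrow> h (c \<odot>\<^bsub>A\<^esub> x) = c \<odot>\<^bsub>B\<^esub> h x"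
    and h_grade: "\<And>d. h ` grade A d = grade B d"
    using iso by (auto simp: graded_algebra_iso_def ring_iso_def)
  interpret A: ring A by fact
  interpret B: ring B by fact
  interpret h: ring_hom_ring A B h
    by unfold_locales (rule hom)
  interpret I: ideal I A by fact
  interpret J: ideal "h ` I" B by fact
  have surj: "h ` carrier A = carrier B" and inj: "inj_on h (carrier A)"
    using bij by (auto simp: bij_betw_def)
  have coset: "h ` (I +>\<^bsub>A\<^esub> x) = h ` I +>\<^bsub>B\<^esub> h x" if "x \<in> carrier A" for x
  proof -
    have "h (i \<oplus>\<^bsub>A\<^esub> x) = h i \<oplus>\<^bsub>B\<^esub> h x" if "i \<in> I" for i
      using that \<open>x \<in> carrier A\<close> I.Icarr by simp
    then show ?thesis
      by (simp add: a_r_coset_def' image_UN)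
  qed
  have quot_carrier: "carrier (A GQuot I) = (\<lambda>x. I +>\<^bsub>A\<^esub> x) ` carrier A"
    "carrier (B GQuot (h ` I)) = (\<lambda>x. h ` I +>\<^bsub>B\<^esub> x) ` carrier B"
    by (auto simp: graded_quot_def FactRing_def A_RCOSETS_def')
  have A_rep: "\<exists>x\<in>carrier A. X = I +>\<^bsub>A\<^esub> x" if "X \<in> carrier (A GQuot I)" for X
    using that by (auto simp: quot_carrier)
  have sub: "X \<subseteq> carrier A" if "X \<in> carrier (A GQuot I)" for X
    using A_rep[OF that] A.a_r_coset_subset_G[OF I.a_subset] by blast
  have "(`) h \<in> ring_iso (A GQuot I) (B GQuot (h ` I))"
  proof (rule ring_iso_memI)
    show "h ` X \<in> carrier (B GQuot (h ` I))" if "X \<in> carrier (A GQuot I)" for X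
      using A_rep[OF that] coset surj by (auto simp: quot_carrier)
    show "h ` (X \<otimes>\<^bsub>A GQuot I\<^esub> Y) = h ` X \<otimes>\<^bsub>B GQuot (h ` I)\<^esub> h ` Y"
      if XY: "X \<in> carrier (A GQuot I)" "Y \<in> carrier (A GQuot I)" for X Y
    proof -
      obtain x y where "x \<in> carrier A" "X = I +>\<^bsub>A\<^esub> x" "y \<in> carrier A" "Y = I +>\<^bsub>A\<^esub> y"
        using XY A_rep by blast
      then show ?thesis
        by (simp add: graded_quot_def FactRing_def coset I.rcoset_mult_add J.rcoset_mult_add)
    qed
    show "h ` (X \<oplus>\<^bsub>A GQuot I\<^esub> Y) = h ` X \<oplus>\<^bsub>B GQuot (h ` I)\<^esub> h ` Y"
      if XY: "X \<in> carrier (A GQuot I)" "Y \<in> carrier (A GQuot I)" for X Y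
    proof -
      obtain x y where "x \<in> carrier A" "X = I +>\<^bsub>A\<^esub> x" "y \<in> carrier A" "Y = I +>\<^bsub>A\<^esub> y"
        using XY A_rep by blast
      then show ?thesis
        by (simp add: graded_quot_def FactRing_def coset I.a_rcos_sum J.a_rcos_sum)
    qed
    show "h ` \<one>\<^bsub>A GQuot I\<^esub> = \<one>\<^bsub>B GQuot (h ` I)\<^esub>"
      by (simp add: graded_quot_def FactRing_def coset)
    have "inj_on ((`) h) (carrier (A GQuot I))"
      using inj sub by (intro inj_onI) (metis inj_on_image_eq_iff)
    moreover have "(`) h ` carrier (A GQuot I) = carrier (B GQuot (h ` I))"
      unfolding quot_carrier image_image surj[symmetric] by (intro image_cong) (auto simp: coset)
    ultimately show "bij_betw ((`) h) (carrier (A GQuot I)) (carrier (B GQuot (h ` I)))"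
      by (simp add: bij_betw_def)
  qed
  moreover have "h ` (c \<odot>\<^bsub>A GQuot I\<^esub> X) = c \<odot>\<^bsub>B GQuot (h ` I)\<^esub> (h ` X)"
    if "X \<in> carrier (A GQuot I)" for c X
  proof -
    have "h ` (I +>\<^bsub>A\<^esub> (c \<odot>\<^bsub>A\<^esub> x)) = h ` I +>\<^bsub>B\<^esub> (c \<odot>\<^bsub>B\<^esub> h x)" if "x \<in> X" for x
      using sub[OF \<open>X \<in> _\<close>] that by (simp add: coset smult h_smult subset_iff)
    then show ?thesis
      by (simp add: graded_quot_def image_UN)
  qed
  moreover have "(`) h ` grade (A GQuot I) d = grade (B GQuot (h ` I)) d" for d
  proof -
    have "h ` (I +>\<^bsub>A\<^esub> x) = h ` I +>\<^bsub>B\<^esub> h x" if "x \<in> grade A d" for x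
      using grade that by (intro coset) blast
    then show ?thesis
      by (simp add: graded_quot_def image_image cong: image_cong_simp flip: h_grade)
  qed
  ultimately show ?thesis
    unfolding graded_isomorphic_def graded_algebra_iso_def by blast
qed

section \<open>The two presentations\<close>

lemma polyring_e_cring: "cring polyring_e"
proof (rule cringI)
  show "abelian_group polyring_e"
    by (rule abelian_groupI) (auto simp: polyring_e_def algebra_simps intro: exI[of _ "- x" for x])
  show "Group.comm_monoid polyring_e"
    by (rule comm_monoidI) (auto simp: polyring_e_def algebra_simps)
qed (auto simp: polyring_e_def algebra_simps)

lemma polyring_e_ring: "ring polyring_e"
  using polyring_e_cring by (rule cring.axioms)

lemma ideal_polyring_eI:
  assumes "0 \<in> I" "\<And>a b. a \<in> I \<Longrightarrow> b \<in> I \<Longrightarrow> a - b \<in> I" "\<And>a b. b \<in> I \<Longrightarrow> a * b \<in> I"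
  shows "ideal I polyring_e"
proof (rule idealI)
  interpret ring polyring_e by (rule polyring_e_ring)
  have minus: "\<ominus>\<^bsub>polyring_e\<^esub> a = - a" for a
    by (rule minus_equality) (auto simp: polyring_e_def)
  have uminus: "- a \<in> I" if "a \<in> I" for a
    using assms(2)[OF assms(1) that] by simp
  show "subgroup I (add_monoid polyring_e)"
  proof (rule add.subgroupI)
    show "a \<oplus>\<^bsub>polyring_e\<^esub> b \<in> I" if "a \<in> I" "b \<in> I" for a b
      using assms(2)[OF that(1) uminus[OF that(2)]] by (simp add: polyring_e_def)
  qed (use assms(1) minus uminus in \<open>auto simp: polyring_e_def\<close>)
  show "ring polyring_e"
    by (rule ring_axioms)
qed (use assms(3) in \<open>auto simp: polyring_e_def mult.commute\<close>)

lemma ideal_polyring_eD: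
  assumes "ideal I polyring_e"
  shows "a \<in> I \<Longrightarrow> b \<in> I \<Longrightarrow> a + b \<in> I" "b \<in> I \<Longrightarrow> a * b \<in> I"
  using ideal.I_l_closed[OF assms, of b a] additive_subgroup.a_closed[OF ideal.axioms(1)[OF assms], of a b]
  by (simp_all add: polyring_e_def)

lemma sym_eval_iso: "sym_eval \<in> graded_algebra_iso polyring_e symring"
  using inj_sym_eval
  by (auto simp: graded_algebra_iso_def polyring_e_def symring_def sym_eval_mult sym_eval_add
      sym_eval_const2 bij_betw_def intro!: ring_iso_memI)

lemma symring_ring: "ring symring"
proof -
  have "ring (symring \<lparr>zero := sym_eval \<zero>\<^bsub>polyring_e\<^esub>\<rparr>)"
    using sym_eval_iso
    by (intro ring.ring_iso_imp_img_ring[OF polyring_e_ring]) (simp add: graded_algebra_iso_def)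
  then show ?thesis
    by (simp add: polyring_e_def symring_def)
qed

lemma graded_algebra_iso_inv:
  assumes "ring A" "h \<in> graded_algebra_iso A B" 
    and smult: "\<And>c x. x \<in> carrier A \<Longrightarrow> c \<odot>\<^bsub>A\<^esub> x \<in> carrier A"
    and grade: "\<And>d. grade A d \<subseteq> carrier A"
  shows "inv_into (carrier A) h \<in> graded_algebra_iso B A"
proof -
  let ?g = "inv_into (carrier A) h"
  have h: "h \<in> ring_iso A B" and h_smult: "\<And>c x. x \<in> carrier A \<Longrightarrow> h (c \<odot>\<^bsub>A\<^esub> x) = c \<odot>\<^bsub>B\<^esub> h x"
    and h_grade: "\<And>d. h ` grade A d = grade B d"
    using assms(2) by (auto simp: graded_algebra_iso_def)
  have inv: "?g (h x) = x" if "x \<in> carrier A" for x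
    using h that by (auto simp: ring_iso_def bij_betw_def)
  have "?g (c \<odot>\<^bsub>B\<^esub> y) = c \<odot>\<^bsub>A\<^esub> ?g y" if "y \<in> carrier B" for c y
  proof -
    have "y \<in> h ` carrier A"
      using h that by (simp add: ring_iso_def bij_betw_def)
    then obtain x where "x \<in> carrier A" "y = h x"
      by blast
    then show ?thesis
      using inv smult by (simp flip: h_smult)
  qed
  moreover have "?g ` grade B d = grade A d" for d
    using grade[of d] inv by (force simp: image_image simp flip: h_grade)
  ultimately show ?thesis
    using ring_iso_set_sym[OF assms(1) h] by (simp add: graded_algebra_iso_def)
qed

lemma Idl_eq_Ann_F_poly:
  assumes "m \<ge> 1"
  shows "Idl\<^bsub>polyring_e\<^esub> {f_poly m, V2 ^ m} = Ann (F_poly m)"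
proof
  interpret ring polyring_e by (rule polyring_e_ring)
  have "ideal (Ann (F_poly m)) polyring_e"
    by (intro ideal_polyring_eI Ann_closed) (simp add: Ann_def)
  moreover have "{f_poly m, V2 ^ m} \<subseteq> Ann (F_poly m)"
    using f_poly_diff_act_F_poly[OF assms] V2_power_diff_act_F_poly[OF assms, of m]
    by (simp add: Ann_def ballot_form_def)
  ultimately show "Idl\<^bsub>polyring_e\<^esub> {f_poly m, V2 ^ m} \<subseteq> Ann (F_poly m)"
    by (rule genideal_minimal)
  have sub: "{f_poly m, V2 ^ m} \<subseteq> carrier polyring_e"
    by (simp add: polyring_e_def)
  note ideal = genideal_ideal[OF sub]
  show "Ann (F_poly m) \<subseteq> Idl\<^bsub>polyring_e\<^esub> {f_poly m, V2 ^ m}"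
  proof
    fix g
    assume "g \<in> Ann (F_poly m)"
    then show "g \<in> Idl\<^bsub>polyring_e\<^esub> {f_poly m, V2 ^ m}"
      by (rule Ann_F_poly_subset[OF assms])
        (use ideal_polyring_eD[OF ideal] genideal_self[OF sub] in simp_all)
  qed
qed

theorem theorem3:
  fixes m :: nat
  assumes "m \<ge> 1"
  shows "A2 m \<cong>\<^sub>g\<^sub>r polyring_e GQuot (Idl\<^bsub>polyring_e\<^esub> {f_poly m, V2 ^ m}) \<and>
         polyring_e GQuot (Idl\<^bsub>polyring_e\<^esub> {f_poly m, V2 ^ m}) = polyring_e GQuot (Ann (F_poly m))"
proof
  (* A symmetric polynomial is sent to its expression in the elementary ones. *)
  let ?g = "inv_into (carrier polyring_e) sym_eval"
  interpret P: ring polyring_e by (rule polyring_e_ring)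
  interpret S: ring symring by (rule symring_ring)
  have g: "?g \<in> graded_algebra_iso symring polyring_e"
    by (rule graded_algebra_iso_inv[OF polyring_e_ring sym_eval_iso]) (simp_all add: polyring_e_def)
  have "?g (sym_eval p) = p" for p
    by (simp add: polyring_e_def inj_sym_eval)
  moreover have e_pow: "e1pow m = sym_eval (f_poly m)" "e2pow m = sym_eval (V2 ^ m)"
    using assms by (simp_all add: f_poly_eq_lucas sym_eval_lucas e2pow_def sym_eval_power sym_eval_V2
        power_mult_distrib)
  ultimately have gens: "?g ` {e1pow m, e2pow m} = {f_poly m, V2 ^ m}"
    by simp
  have sub: "{e1pow m, e2pow m} \<subseteq> carrier symring"
    by (simp add: symring_def e_pow)
  have Idl: "?g ` (Idl\<^bsub>symring\<^esub> {e1pow m, e2pow m}) = Idl\<^bsub>polyring_e\<^esub> {f_poly m, V2 ^ m}"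
    unfolding gens[symmetric]
    using g sub by (intro ring_iso_image_Idl polyring_e_ring symring_ring) (simp add: graded_algebra_iso_def)
  show "A2 m \<cong>\<^sub>g\<^sub>r polyring_e GQuot (Idl\<^bsub>polyring_e\<^esub> {f_poly m, V2 ^ m})"
    unfolding A2_def Idl[symmetric]
  proof (rule GQuot_graded_isomorphic[OF symring_ring polyring_e_ring g])
    show "ideal (Idl\<^bsub>symring\<^esub> {e1pow m, e2pow m}) symring"
      by (rule S.genideal_ideal[OF sub])
    show "ideal (?g ` (Idl\<^bsub>symring\<^esub> {e1pow m, e2pow m})) polyring_e"
      unfolding Idl by (rule P.genideal_ideal) (simp add: polyring_e_def)
    show "c \<odot>\<^bsub>symring\<^esub> x \<in> carrier symring" if "x \<in> carrier symring" for c x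
    proof -
      obtain p where "x = sym_eval p"
        using \<open>x \<in> carrier symring\<close> by (auto simp: symring_def)
      then have "c \<odot>\<^bsub>symring\<^esub> x = sym_eval (const2 c * p)"
        by (simp add: symring_def sym_eval_mult sym_eval_const2)
      then show ?thesis
        by (simp add: symring_def)
    qed
  qed (auto simp: symring_def)
  show "polyring_e GQuot (Idl\<^bsub>polyring_e\<^esub> {f_poly m, V2 ^ m}) = polyring_e GQuot (Ann (F_poly m))"
    by (simp only: Idl_eq_Ann_F_poly[OF assms])
qed

end
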